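(* Let $a\ge 1$ and $0\le b\le a$ be integers with $a\equiv b \pmod 2$, let $\sigma\in\{\text{sink},\text{source}\}$ (with $\sigma=\text{sink}$ when $b=0$), let $n=a+b$, and let $k=\frac{a-b}{2}$ if $\sigma=\text{sink}$ and $k=\frac{a+b}{2}$ if $\sigma=\text{source}$. Consider the experiment graph $\mathtt{G}(a,b,\sigma)$ with set of signal paths $A$, $|A|=a$. For every $S\subseteq A$ with $|S|=k$, the number of coincidences $M$ of $\mathtt{G}(a,b,\sigma)$ registering the excitation pattern $S$ (i.e. with $\operatorname{sig}(M)=S$) is $$\mu(S)=\Bigl(\frac n2\Bigr)!.$$ In particular, all $\binom{a}{k}$ patterns of weight $k$ on the $a$ signal modes occur, and $$\ket{\psi_{\mathtt{G}(a,b,\sigma)}}\;\propto\;\ket{D_k^a}\otimes\ket{0}^{\otimes b},$$ where $\ket{x}$ denotes the computational basis vector indexed by the bitstring $x$.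
   Context: Here $\ket{x}:=\left|x\right\rangle$. An experiment graph is a finite loopless multigraph $G=(V,E)$ (vertices are called paths, edges are called crystals; parallel edges are distinct crystals) together with a half-edge coloring assigning to each of the two arms (edge–endpoint incidences) of each crystal a mode: excited ($1$) or ground ($0$). For a crystal $e$, $R(e)$ is the set of endpoints of $e$ at which the arm of $e$ is excited. A coincidence is a perfect matching $M$ of $G$ (a set of edges covering every vertex exactly once). The registered pattern of a coincidence $M$ is $\operatorname{sig}(M)=\bigsqcup_{e\in M}R(e)\subseteq V$, identified with the bitstring in $\{0,1\}^V$ that is its indicator vector. All crystals have weight $1$. The (unnormalized) post-selected state is $\ket{\psi_G}\propto\sum_{M}\ket{\operatorname{sig}(M)}=\sum_{x\in\{0,1\}^V}\mu(x)\ket{x}$, the first sum being over all perfect matchings $M$ of $G$, where $\mu(x)$ is the number of perfect matchings $M$ with $\operatorname{sig}(M)=x$. The experiment graph $\mathtt{G}(a,b,\sigma)$: its vertex set is the disjoint union $A\sqcup B$ with $|A|=a$ (signal paths) and $|B|=b$ (spectator paths). For each pair $\{i,j\}\subseteq A$ with $i\ne j$ there are exactly two parallel crystals, one excited at $i$ and ground at $j$, the other ground at $i$ and excited at $j$. There are no crystals between two vertices of $B$. Each $v\in B$ is joined to each $i\in A$ by a single crystal, which is ground at both $i$ and $v$ if $\sigma=\text{sink}$, and excited at $i$ and ground at $v$ if $\sigma=\text{source}$. The Dicke state is $\ket{D_k^N}=\binom{N}{k}^{-1/2}\sum_{x\in\{0,1\}^N,\,H(x)=k}\ket{x}$, where $H(x)$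 is the Hamming weight (number of ones). In $\ket{D_k^a}\otimes\ket{0}^{\otimes b}$ the first $a$ modes are those of $A$ and the last $b$ are those of $B$. *)

theory Defs
  imports Complex_Main "HOL-Library.FuncSet"
begin

datatype mode = Ground | Excited

text \<open>
  A half-edge coloring gives a mode to every arm (crystal, endpoint); the value of \<open>arm e v\<close>
  is irrelevant unless \<open>v \<in> ends e\<close>. Parallel crystals are different elements of \<open>crystals\<close>
  with the same \<open>ends\<close>.
\<close>

record ('v, 'e) egraph =
  paths :: "'v set"
  crystals :: "'e set"
  ends :: "'e \<Rightarrow> 'v set"
  arm :: "'e \<Rightarrow> 'v \<Rightarrow> mode"

definition experiment_graph :: "('v, 'e) egraph \<Rightarrow> bool" where
  "experiment_graph G \<longleftrightarrow>
     finite (paths G) \<and> finite (crystals G) \<and>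
     (\<forall>e\<in>crystals G. ends G e \<subseteq> paths G \<and> card (ends G e) = 2)"

definition excited_ends :: "('v, 'e) egraph \<Rightarrow> 'e \<Rightarrow> 'v set" where
  "excited_ends G e = {v \<in> ends G e. arm G e v = Excited}"

definition coincidences :: "('v, 'e) egraph \<Rightarrow> 'e set set" where
  "coincidences G = {M. M \<subseteq> crystals G \<and> (\<forall>v\<in>paths G. \<exists>!e. e \<in> M \<and> v \<in> ends G e)}"

text \<open>The union is automatically disjoint when \<open>M\<close> is a perfect matching of an experiment graph.\<close>

definition sig :: "('v, 'e) egraph \<Rightarrow> 'e set \<Rightarrow> 'v set" where
  "sig G M = (\<Union>e\<in>M. excited_ends G e)"

text \<open>
  \<open>bitstrings V\<close> is the set of 0/1-valued functions on \<open>V\<close>, represented extensionally, and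
  \<open>bits V S\<close> is the indicator vector of \<open>S \<subseteq> V\<close>. A vector of the state space of the modes \<open>V\<close>
  is a complex function of bitstrings that vanishes off \<open>bitstrings V\<close>.
\<close>

definition bitstrings :: "'v set \<Rightarrow> ('v \<Rightarrow> nat) set" where
  "bitstrings V = V \<rightarrow>\<^sub>E {0, 1}"

definition bits :: "'v set \<Rightarrow> 'v set \<Rightarrow> 'v \<Rightarrow> nat" where
  "bits V S = (\<lambda>v\<in>V. if v \<in> S then 1 else 0)"

definition hamming :: "'v set \<Rightarrow> ('v \<Rightarrow> nat) \<Rightarrow> nat" where
  "hamming V x = card {v \<in> V. x v = 1}"

type_synonym 'v state = "('v \<Rightarrow> nat) \<Rightarrow> complex"

definition ket :: "('v \<Rightarrow> nat) \<Rightarrow> 'v state" where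
  "ket x = (\<lambda>y. if y = x then 1 else 0)"

definition mu :: "('v, 'e) egraph \<Rightarrow> ('v \<Rightarrow> nat) \<Rightarrow> nat" where
  "mu G x = card {M \<in> coincidences G. bits (paths G) (sig G M) = x}"

definition psi :: "('v, 'e) egraph \<Rightarrow> 'v state" where
  "psi G = (\<lambda>y. \<Sum>M\<in>coincidences G. ket (bits (paths G) (sig G M)) y)"

definition dicke :: "'v set \<Rightarrow> nat \<Rightarrow> 'v state" where
  "dicke N k = (\<lambda>y. complex_of_real (1 / sqrt (real (card N choose k))) *
                     (\<Sum>x\<in>{x \<in> bitstrings N. hamming N x = k}. ket x y))"

definition zero_state :: "'v set \<Rightarrow> 'v state" where
  "zero_state N = ket (\<lambda>v\<in>N. 0)"

text \<open>Tensor product of states on disjoint sets of modes \<open>A\<close> and \<open>B\<close>.\<close>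

definition tensor :: "'v set \<Rightarrow> 'v set \<Rightarrow> 'v state \<Rightarrow> 'v state \<Rightarrow> 'v state" where
  "tensor A B \<phi> \<chi> = (\<lambda>x. if x \<in> bitstrings (A \<union> B)
                           then \<phi> (restrict x A) * \<chi> (restrict x B) else 0)"

definition proportional :: "'v state \<Rightarrow> 'v state \<Rightarrow> bool" where
  "proportional \<phi> \<chi> \<longleftrightarrow> (\<exists>c::complex. c \<noteq> 0 \<and> (\<forall>x. \<phi> x = c * \<chi> x))"

datatype kind = Sink | Source

text \<open>
  \<open>SS i j\<close> is the crystal between signal paths that is excited at \<open>i\<close> and ground at \<open>j\<close>, so
  \<open>SS i j\<close> and \<open>SS j i\<close> are the two parallel crystals on \<open>{i, j}\<close>; \<open>BS v i\<close> joins the spectator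
  \<open>v\<close> to the signal path \<open>i\<close>.
\<close>

datatype 'v crystal = SS 'v 'v | BS 'v 'v

fun crystal_ends :: "'v crystal \<Rightarrow> 'v set" where
  "crystal_ends (SS i j) = {i, j}"
| "crystal_ends (BS v i) = {v, i}"

fun crystal_arm :: "kind \<Rightarrow> 'v crystal \<Rightarrow> 'v \<Rightarrow> mode" where
  "crystal_arm \<sigma> (SS i j) u = (if u = i then Excited else Ground)"
| "crystal_arm \<sigma> (BS v i) u = (if \<sigma> = Source \<and> u = i then Excited else Ground)"

definition GG :: "'v set \<Rightarrow> 'v set \<Rightarrow> kind \<Rightarrow> ('v, 'v crystal) egraph" where
  "GG A B \<sigma> =
     \<lparr> paths = A \<union> B,
       crystals = {SS i j | i j. i \<in> A \<and> j \<in> A \<and> i \<noteq> j} \<union> {BS v i | v i. v \<in> B \<and> i \<in> A},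
       ends = crystal_ends,
       arm = crystal_arm \<sigma> \<rparr>"

lemma experiment_graph_GG:
  assumes "finite A" "finite B" "A \<inter> B = {}"
  shows "experiment_graph (GG A B \<sigma>)"
proof -
  have "crystals (GG A B \<sigma>) \<subseteq> (\<lambda>(i, j). SS i j) ` (A \<times> A) \<union> (\<lambda>(v, i). BS v i) ` (B \<times> A)"
    by (auto simp: GG_def)
  then have "finite (crystals (GG A B \<sigma>))"
    by (rule finite_subset) (use assms in auto)
  then show ?thesis
    using assms by (auto simp: experiment_graph_def GG_def card_insert_if)
qed

lemma bits_eq_iff: "S \<subseteq> V \<Longrightarrow> T \<subseteq> V \<Longrightarrow> bits V S = bits V T \<longleftrightarrow> S = T"
proof
  assume "S \<subseteq> V" "T \<subseteq> V" and eq: "bits V S = bits V T"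
  have "v \<in> S \<longleftrightarrow> v \<in> T" if "v \<in> V" for v
    using fun_cong[OF eq, of v] that by (auto simp: bits_def split: if_splits)
  with \<open>S \<subseteq> V\<close> \<open>T \<subseteq> V\<close> show "S = T" by blast
qed simp

lemma sig_subset:
  assumes "experiment_graph G" "M \<in> coincidences G"
  shows "sig G M \<subseteq> paths G"
  using assms by (fastforce simp: experiment_graph_def coincidences_def sig_def excited_ends_def)

lemma mu_bits:
  assumes "experiment_graph G" "S \<subseteq> paths G"
  shows "mu G (bits (paths G) S) = card {M \<in> coincidences G. sig G M = S}"
  unfolding mu_def using assms sig_subset bits_eq_iff by (metis (no_types, lifting))

lemma psi_eq_mu:
  assumes "experiment_graph G"
  shows "psi G y = (\<Sum>x\<in>bitstrings (paths G). of_nat (mu G x) * ket x y)"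
proof -
  let ?V = "paths G"
  have "coincidences G \<subseteq> Pow (crystals G)" by (auto simp: coincidences_def)
  then have fin: "finite (coincidences G)"
    using assms by (meson experiment_graph_def finite_Pow_iff finite_subset)
  have finV: "finite (bitstrings ?V)"
    using assms by (auto simp: experiment_graph_def bitstrings_def intro: finite_PiE)
  have im: "(\<lambda>M. bits ?V (sig G M)) ` coincidences G \<subseteq> bitstrings ?V"
    unfolding bits_def bitstrings_def by (rule image_subsetI) simp
  have "psi G y = (\<Sum>x\<in>bitstrings ?V. \<Sum>M\<in>{M \<in> coincidences G. bits ?V (sig G M) = x}.
                      ket (bits ?V (sig G M)) y)"
    unfolding psi_def by (rule sum.group[OF fin finV im, symmetric])
  also have "\<dots> = (\<Sum>x\<in>bitstrings ?V. of_nat (mu G x) * ket x y)"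
    by (rule sum.cong) (auto simp: mu_def)
  finally show ?thesis .
qed

end

theory Submission imports Defs
begin

text \<open>
  Fix \<open>S \<subseteq> A\<close>. A coincidence registering \<open>S\<close> joins, by every crystal between signal paths, an element
  of \<open>S\<close> to one of \<open>A - S\<close>, and at a spectator it uses a signal path outside \<open>S\<close> (sink) or inside \<open>S\<close>
  (source). So the coincidences registering \<open>S\<close> are exactly the perfect matchings of a complete simple
  bipartite graph, whose sides are \<open>S \<union> B\<close> and \<open>A - S\<close> for a sink and \<open>(A - S) \<union> B\<close> and \<open>S\<close> for a
  source. These correspond to bijections between the sides, and the sides have equal size (then \<open>n / 2\<close>)
  precisely when \<open>S\<close> has \<open>k\<close> elements.
\<close>

section \<open>Perfect matchings of a complete bipartite graph\<close>

lemma card_PiE_bij_betw: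
  assumes "finite X" "finite Y"
  shows "card {f \<in> X \<rightarrow>\<^sub>E Y. bij_betw f X Y} = (if card X = card Y then fact (card X) else 0)"
proof (cases "card X = card Y")
  case True
  \<comment> \<open>Between finite sets of equal size an injection is onto, so the falling-factorial
    count of injections applies and reduces to a factorial.\<close>
  have "bij_betw f X Y \<longleftrightarrow> inj_on f X" if "f \<in> X \<rightarrow>\<^sub>E Y" for f
  proof
    assume inj: "inj_on f X"
    have "f ` X \<subseteq> Y" using that by auto
    then have "f ` X = Y"
      using card_subset_eq[OF assms(2)] card_image[OF inj] True by simp
    with inj show "bij_betw f X Y" by (simp add: bij_betw_def)
  qed (simp add: bij_betw_def)
  then have "{f \<in> X \<rightarrow>\<^sub>E Y. bij_betw f X Y} = {f \<in> X \<rightarrow>\<^sub>E Y. inj_on f X}" by blast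
  then show ?thesis
    using card_inj_on_subset_funcset[OF assms subset_refl] True by (simp add: fact_prod_rev)
next
  case False
  then have "{f \<in> X \<rightarrow>\<^sub>E Y. bij_betw f X Y} = {}" by (auto dest: bij_betw_same_card)
  with False show ?thesis by (simp only: card.empty if_False)
qed

text \<open>\<open>w\<close> selects one crystal of \<open>G\<close> for each pair in
  \<open>X \<times> Y\<close>; \<open>G\<close> may have others. A bijection \<open>f\<close>
  corresponds to the matching of all \<open>w x (f x)\<close>, and taking \<open>f\<close>
  extensional makes this correspondence one-to-one.\<close>

lemma card_bipartite_coincidences:
  assumes fin: "finite X" "finite Y" and disj: "X \<inter> Y = {}" and paths: "paths G = X \<union> Y"
    and w: "\<And>x y. x \<in> X \<Longrightarrow> y \<in> Y \<Longrightarrow> w x y \<in> crystals G \<and> ends G (w x y) = {x, y}"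
  shows "card {M \<in> coincidences G. M \<subseteq> case_prod w ` (X \<times> Y)}
           = (if card X = card Y then fact (card X) else 0)"
proof -
  let ?F = "{f \<in> X \<rightarrow>\<^sub>E Y. bij_betw f X Y}"
  let ?m = "\<lambda>f. (\<lambda>x. w x (f x)) ` X"
  \<comment> \<open>The ends \<open>{x, y}\<close> determine \<open>x\<close> and \<open>y\<close>
    because the sides are disjoint.\<close>
  have w_eq: "x = x' \<and> y = y'"
    if "w x y = w x' y'" "x \<in> X" "y \<in> Y" "x' \<in> X" "y' \<in> Y" for x y x' y'
    using w[OF that(2,3)] w[OF that(4,5)] that disj by (auto simp: doubleton_eq_iff)
  have "?m ` ?F = {M \<in> coincidences G. M \<subseteq> case_prod w ` (X \<times> Y)}"
  proof (intro equalityI subsetI)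
    fix M assume "M \<in> ?m ` ?F"
    then obtain f where f: "f \<in> X \<rightarrow>\<^sub>E Y" "bij_betw f X Y" and M: "M = ?m f" by auto
    have fY: "f x \<in> Y" if "x \<in> X" for x using f that by auto
    have "\<exists>!e. e \<in> M \<and> v \<in> ends G e" if v: "v \<in> X \<union> Y" for v
    proof -
      \<comment> \<open>A vertex of \<open>Y\<close> has a partner because \<open>f\<close> is onto;
        that the partner is unique, below, rests on injectivity.\<close>
      obtain x where x: "x \<in> X" "v = x \<or> v = f x"
        using v f(2) by (auto simp: bij_betw_def)
      have "e = w x (f x)" if e: "e \<in> M" "v \<in> ends G e" for e
      proof -
        obtain x' where x': "x' \<in> X" "e = w x' (f x')" using e M by auto
        then have "v = x' \<or> v = f x'" using e(2) w[OF x'(1) fY[OF x'(1)]] by auto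
        then have "x' = x"
          using x x'(1) fY disj f(2) by (auto simp: bij_betw_def dest: inj_onD)
        then show ?thesis using x' by simp
      qed
      moreover have "w x (f x) \<in> M" "v \<in> ends G (w x (f x))"
        using x M w[OF x(1) fY[OF x(1)]] by auto
      ultimately show ?thesis by blast
    qed
    then show "M \<in> {M \<in> coincidences G. M \<subseteq> case_prod w ` (X \<times> Y)}"
      using M w fY by (auto simp: coincidences_def paths)
  next
    fix M assume "M \<in> {M \<in> coincidences G. M \<subseteq> case_prod w ` (X \<times> Y)}"
    then have uniq: "\<And>v. v \<in> X \<union> Y \<Longrightarrow> \<exists>!e. e \<in> M \<and> v \<in> ends G e"
      and sub: "M \<subseteq> case_prod w ` (X \<times> Y)"
      by (auto simp: coincidences_def paths)
    have unique: "e = e'"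
      if "e \<in> M" "e' \<in> M" "v \<in> ends G e" "v \<in> ends G e'" "v \<in> X \<union> Y" for e e' v
      using uniq that by blast
    have exf: "\<exists>y. y \<in> Y \<and> w x y \<in> M" if "x \<in> X" for x
    proof -
      obtain e where "e \<in> M" "x \<in> ends G e" using uniq \<open>x \<in> X\<close> by blast
      with sub obtain x' y where xy: "x' \<in> X" "y \<in> Y" "e = w x' y" by auto
      then have "x = x'" using w[OF xy(1,2)] \<open>x \<in> ends G e\<close> that disj by auto
      then show ?thesis using xy \<open>e \<in> M\<close> by blast
    qed
    \<comment> \<open>The partner of \<open>x\<close> in \<open>M\<close>; the restriction to
      \<open>X\<close> puts \<open>f\<close> into the extensional function space.\<close>
    define f where "f = (\<lambda>x\<in>X. SOME y. y \<in> Y \<and> w x y \<in> M)"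
    have f: "f x \<in> Y" "w x (f x) \<in> M" if "x \<in> X" for x
      using someI_ex[OF exf[OF that]] that by (auto simp: f_def)
    \<comment> \<open>Two crystals of \<open>M\<close> that share the end \<open>x\<close> coincide,
      so the choice made by \<open>SOME\<close> is the only possible one.\<close>
    have f_eq: "f x = y" if "x \<in> X" "y \<in> Y" "w x y \<in> M" for x y
    proof -
      have "w x y = w x (f x)"
        using that f[OF that(1)] w[OF that(1,2)] w[OF that(1) f(1)[OF that(1)]]
        by (intro unique[of _ _ x]) auto
      then show ?thesis using w_eq that f by blast
    qed
    \<comment> \<open>The same argument at the other end: crystals of \<open>M\<close> meeting in
      \<open>f x\<close> coincide.\<close>
    have "inj_on f X"
    proof (rule inj_onI)
      fix x x' assume x: "x \<in> X" "x' \<in> X" "f x = f x'"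
      then have "w x (f x) = w x' (f x')"
        using x f[OF x(1)] f[OF x(2)] w[OF x(1) f(1)[OF x(1)]] w[OF x(2) f(1)[OF x(2)]]
        by (intro unique[of _ _ "f x"]) auto
      then show "x = x'" using w_eq x f by blast
    qed
    moreover have "y \<in> f ` X" if y: "y \<in> Y" for y
    proof -
      obtain e where "e \<in> M" "y \<in> ends G e" using uniq y by blast
      with sub obtain x y' where xy: "x \<in> X" "y' \<in> Y" "e = w x y'" by auto
      then have "y = y'" using w[OF xy(1,2)] \<open>y \<in> ends G e\<close> y disj by auto
      then show ?thesis using f_eq xy \<open>e \<in> M\<close> by blast
    qed
    ultimately have "f \<in> ?F"
      using f by (auto simp: bij_betw_def f_def)
    moreover have "M = ?m f"
    proof (intro equalityI subsetI)
      fix e assume "e \<in> M"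
      with sub obtain x y where xy: "x \<in> X" "y \<in> Y" "e = w x y" by auto
      then have "f x = y" using f_eq \<open>e \<in> M\<close> by blast
      then show "e \<in> ?m f" using xy by blast
    qed (use f in auto)
    ultimately show "M \<in> ?m ` ?F" by blast
  qed
  then have "card {M \<in> coincidences G. M \<subseteq> case_prod w ` (X \<times> Y)} = card (?m ` ?F)"
    by (rule arg_cong[OF sym])
  moreover have "inj_on ?m ?F"
  proof (rule inj_onI)
    fix f g assume fg: "f \<in> ?F" "g \<in> ?F" "?m f = ?m g"
    have "f x = g x" if x: "x \<in> X" for x
    proof -
      obtain x' where x': "x' \<in> X" "w x (f x) = w x' (g x')" using fg(3) x by blast
      then show ?thesis using w_eq[OF x'(2)] x fg by auto
    qed
    then show "f = g" using fg by (auto intro: PiE_ext)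
  qed
  ultimately show ?thesis by (simp only: card_image card_PiE_bij_betw[OF fin])
qed

section \<open>Coincidences registering a given pattern\<close>

text \<open>Spectator arms are ground for both kinds, so only signal paths can be
  registered.\<close>

lemma sig_GG_subset:
  assumes "M \<in> coincidences (GG A B \<sigma>)" "A \<inter> B = {}"
  shows "sig (GG A B \<sigma>) M \<subseteq> A"
proof
  fix u assume "u \<in> sig (GG A B \<sigma>) M"
  then obtain e where "e \<in> M" "u \<in> crystal_ends e" "crystal_arm \<sigma> e u = Excited"
    by (auto simp: sig_def excited_ends_def GG_def)
  moreover from this have "e \<in> crystals (GG A B \<sigma>)"
    using assms by (auto simp: coincidences_def)
  ultimately show "u \<in> A"
    by (auto simp: GG_def split: if_splits)
qed

text \<open>Only one crystal of \<open>M\<close> covers \<open>v\<close>, so its ground arm alone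
  decides that \<open>v\<close> is not registered.\<close>

lemma not_in_sig:
  assumes "M \<in> coincidences G" "e \<in> M" "v \<in> paths G" "v \<in> ends G e" "arm G e v = Ground"
  shows "v \<notin> sig G M"
proof
  assume "v \<in> sig G M"
  then obtain e' where "e' \<in> M" "v \<in> ends G e'" "arm G e' v = Excited"
    by (auto simp: sig_def excited_ends_def)
  moreover have "\<exists>!e. e \<in> M \<and> v \<in> ends G e" using assms by (simp add: coincidences_def)
  ultimately have "e' = e" using assms by blast
  then show False using assms \<open>arm G e' v = Excited\<close> by simp
qed

text \<open>Of two parallel signal crystals, \<open>S\<close> admits at most the one whose excited
  end lies in \<open>S\<close>. The size of \<open>S\<close> is left open: unequal sides give the
  count zero, which later excludes patterns of other weights.\<close>

lemma card_coincidences_GG: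
  assumes fin: "finite A" "finite B" and disj: "A \<inter> B = {}" and S: "S \<subseteq> A"
    and X: "X = (case \<sigma> of Sink \<Rightarrow> S | Source \<Rightarrow> A - S) \<union> B"
    and Y: "Y = (case \<sigma> of Sink \<Rightarrow> A - S | Source \<Rightarrow> S)"
  shows "card {M \<in> coincidences (GG A B \<sigma>). sig (GG A B \<sigma>) M = S}
           = (if card X = card Y then fact (card X) else 0)"
proof -
  let ?G = "GG A B \<sigma>"
  \<comment> \<open>The first argument of \<open>SS\<close> is its excited end and must lie in
    \<open>S\<close>. This is part of \<open>X\<close> for a sink but equals \<open>Y\<close> for a
    source, hence the swapped arguments.\<close>
  define w where "w x y = (if x \<in> B then BS x y else case \<sigma> of Sink \<Rightarrow> SS x y | Source \<Rightarrow> SS y x)"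
    for x y
  have w: "w x y \<in> crystals ?G \<and> ends ?G (w x y) = {x, y}" if "x \<in> X" "y \<in> Y" for x y
    using that disj S by (cases \<sigma>) (auto simp: w_def X Y GG_def split: if_splits)
  have paths: "paths ?G = X \<union> Y" using S by (cases \<sigma>) (auto simp: X Y GG_def)
  have "sig ?G M = S \<longleftrightarrow> M \<subseteq> case_prod w ` (X \<times> Y)" if M: "M \<in> coincidences ?G" for M
  proof
    assume sig: "sig ?G M = S"
    show "M \<subseteq> case_prod w ` (X \<times> Y)"
    proof
      fix e assume e: "e \<in> M"
      then have "e \<in> crystals ?G" using M by (auto simp: coincidences_def)
      then consider i j where "e = SS i j" "i \<in> A" "j \<in> A" "i \<noteq> j"
        | v i where "e = BS v i" "v \<in> B" "i \<in> A"
        by (auto simp: GG_def)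
      then show "e \<in> case_prod w ` (X \<times> Y)"
      proof cases
        case 1
        \<comment> \<open>The excited end lies in the registered set; the ground end avoids it
          because nothing else in \<open>M\<close> covers it.\<close>
        have "i \<in> S" using e 1 sig by (force simp: sig_def excited_ends_def GG_def)
        moreover have "j \<notin> S" using not_in_sig[OF M e, of j] 1 sig by (auto simp: GG_def)
        ultimately have "\<sigma> = Sink \<Longrightarrow> e = w i j \<and> i \<in> X \<and> j \<in> Y"
          and "\<sigma> = Source \<Longrightarrow> e = w j i \<and> j \<in> X \<and> i \<in> Y"
          using 1 disj by (auto simp: X Y w_def)
        then show ?thesis by (cases \<sigma>) auto
      next
        case 2
        have "i \<noteq> v" using 2 disj by auto
        have "i \<in> S \<longleftrightarrow> \<sigma> = Source"
        proof
          assume "i \<in> S"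
          then show "\<sigma> = Source" using not_in_sig[OF M e, of i] 2 sig by (cases \<sigma>) (auto simp: GG_def)
        next
          assume "\<sigma> = Source"
          then show "i \<in> S" using e 2 sig by (force simp: sig_def excited_ends_def GG_def)
        qed
        then show ?thesis
          using 2 by (cases \<sigma>) (auto simp: X Y w_def intro!: image_eqI[of _ _ "(v, i)"])
      qed
    qed
  next
    assume sub: "M \<subseteq> case_prod w ` (X \<times> Y)"
    \<comment> \<open>Each selected crystal excites exactly its ends in \<open>S\<close>. Since
      \<open>M\<close> covers every path, the union of these sets is all of
      \<open>S\<close>.\<close>
    have exc: "excited_ends ?G (w x y) = {x, y} \<inter> S" if "x \<in> X" "y \<in> Y" for x y
      using that disj S
      by (cases \<sigma>) (auto simp: excited_ends_def w_def X Y GG_def split: if_splits)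
    have "v \<in> sig ?G M" if v: "v \<in> S" for v
    proof -
      have "v \<in> paths ?G" using v S by (auto simp: GG_def)
      then obtain e where e: "e \<in> M" "v \<in> ends ?G e" using M by (auto simp: coincidences_def)
      then obtain x y where xy: "x \<in> X" "y \<in> Y" "e = w x y" using sub by auto
      then have "v \<in> excited_ends ?G e" using e v w[OF xy(1,2)] exc[OF xy(1,2)] by auto
      then show ?thesis using e by (auto simp: sig_def)
    qed
    moreover have "sig ?G M \<subseteq> S" using sub exc by (fastforce simp: sig_def)
    ultimately show "sig ?G M = S" by blast
  qed
  then have "{M \<in> coincidences ?G. sig ?G M = S}
      = {M \<in> coincidences ?G. M \<subseteq> case_prod w ` (X \<times> Y)}" by blast
  moreover have "finite X" "finite Y" "X \<inter> Y = {}"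
    using fin disj S by (cases \<sigma>; auto simp: X Y intro: finite_subset)+
  ultimately show ?thesis using card_bipartite_coincidences[OF _ _ _ paths w] by simp
qed

text \<open>The sides balance when \<open>card S + b = a - card S\<close> (sink) or
  \<open>a - card S + b = card S\<close> (source), that is, when \<open>card S = k\<close>; each
  side is then half of all paths. Allowing every \<open>S \<subseteq> A \<union> B\<close>
  determines all amplitudes, zeros included.\<close>

lemma mu_GG:
  assumes "finite A" "finite B" "A \<inter> B = {}" "S \<subseteq> A \<union> B"
    and "card B \<le> card A" "even (card A) \<longleftrightarrow> even (card B)"
    and k: "k = (case \<sigma> of Sink \<Rightarrow> (card A - card B) div 2 | Source \<Rightarrow> (card A + card B) div 2)"
  shows "mu (GG A B \<sigma>) (bits (A \<union> B) S)
           = (if S \<subseteq> A \<and> card S = k then fact ((card A + card B) div 2) else 0)"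
proof -
  let ?G = "GG A B \<sigma>"
  have "paths ?G = A \<union> B" by (simp add: GG_def)
  then have mu: "mu ?G (bits (A \<union> B) S) = card {M \<in> coincidences ?G. sig ?G M = S}"
    using mu_bits[OF experiment_graph_GG[OF assms(1-3), of \<sigma>], of S] assms(4) by simp
  show ?thesis
  proof (cases "S \<subseteq> A")
    case False
    then have "{M \<in> coincidences ?G. sig ?G M = S} = {}"
      using sig_GG_subset[OF _ assms(3)] by blast
    then show ?thesis using mu False by (simp only: card.empty) simp
  next
    case True
    define X where "X = (case \<sigma> of Sink \<Rightarrow> S | Source \<Rightarrow> A - S) \<union> B"
    define Y where "Y = (case \<sigma> of Sink \<Rightarrow> A - S | Source \<Rightarrow> S)"
    have finS: "finite S" and le: "card S \<le> card A"
      using True assms(1) by (auto intro: finite_subset card_mono)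
    have "card X = (case \<sigma> of Sink \<Rightarrow> card S | Source \<Rightarrow> card A - card S) + card B"
      unfolding X_def using True assms(1-3) finS
      by (subst card_Un_disjoint) (auto simp: card_Diff_subset split: kind.splits)
    moreover have "card Y = (case \<sigma> of Sink \<Rightarrow> card A - card S | Source \<Rightarrow> card S)"
      unfolding Y_def using True finS by (auto simp: card_Diff_subset split: kind.splits)
    \<comment> \<open>Parity and \<open>card B \<le> card A\<close> provide \<open>p\<close>, so
      both divisions by two are exact and no subtraction is truncated.\<close>
    moreover obtain p where p: "card A = card B + 2 * p"
      using assms(5,6) by (metis dvdE even_add le_Suc_ex)
    then have "(card A + card B) div 2 = card B + p"
      and "k = (case \<sigma> of Sink \<Rightarrow> p | Source \<Rightarrow> card B + p)"
      unfolding k by (cases \<sigma>; simp)+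
    ultimately have "card X = card Y \<longleftrightarrow> card S = k"
      and "card S = k \<Longrightarrow> card X = (card A + card B) div 2"
      using le p by (cases \<sigma>; auto)+
    then show ?thesis
      using mu card_coincidences_GG[OF assms(1-3) True X_def Y_def] True by auto
  qed
qed

section \<open>Amplitudes of the two states\<close>

lemma psi_eq:
  assumes "experiment_graph G"
  shows "psi G y = (if y \<in> bitstrings (paths G) then of_nat (mu G y) else 0)"
proof -
  have "finite (bitstrings (paths G))"
    using assms by (auto simp: experiment_graph_def bitstrings_def intro: finite_PiE)
  then show ?thesis
    by (simp add: psi_eq_mu[OF assms] ket_def if_distrib[of "(*) _"] cong: if_cong)
qed

lemma dicke_eq:
  assumes "finite N"
  shows "dicke N k y = (if y \<in> bitstrings N \<and> hamming N y = k
                        then complex_of_real (1 / sqrt (real (card N choose k))) else 0)"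
proof -
  have "finite (bitstrings N)"
    using assms by (auto simp: bitstrings_def intro: finite_PiE)
  then show ?thesis by (simp add: dicke_def ket_def)
qed

lemma bitstrings_eq_bits:
  assumes "x \<in> bitstrings V"
  shows "x = bits V {v \<in> V. x v = 1}"
proof
  fix v show "x v = bits V {v \<in> V. x v = 1} v"
    using assms by (cases "v \<in> V") (auto simp: bitstrings_def bits_def PiE_def extensional_def Pi_def)
qed

text \<open>The zero ket on \<open>B\<close> forces \<open>S\<close> into \<open>A\<close>; the
  Hamming weight on \<open>A\<close> is then \<open>card S\<close>. This is the support condition
  found in \<open>mu_GG\<close>.\<close>

lemma tensor_dicke_zero_bits:
  assumes "finite A" "A \<inter> B = {}" "S \<subseteq> A \<union> B"
  shows "tensor A B (dicke A k) (zero_state B) (bits (A \<union> B) S)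
           = (if S \<subseteq> A \<and> card S = k then complex_of_real (1 / sqrt (real (card A choose k))) else 0)"
proof -
  let ?x = "bits (A \<union> B) S"
  have "?x \<in> bitstrings (A \<union> B)" "restrict ?x A \<in> bitstrings A"
    by (auto simp: bits_def bitstrings_def)
  moreover have "hamming A (restrict ?x A) = card (S \<inter> A)"
    unfolding hamming_def by (rule arg_cong[of _ _ card]) (auto simp: bits_def)
  moreover have "restrict ?x B = (\<lambda>v\<in>B. 0) \<longleftrightarrow> S \<subseteq> A"
    using assms(2,3) by (auto simp: bits_def restrict_def fun_eq_iff split: if_splits)
  ultimately show ?thesis
    using assms(1) by (auto simp: tensor_def dicke_eq zero_state_def ket_def Int_absorb2)
qed

theorem mainTheorem1:
  fixes a b k n :: nat and A B :: "'v set" and \<sigma> :: kind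
  assumes "1 \<le> a" and "b \<le> a" and "even a \<longleftrightarrow> even b"
    and "b = 0 \<Longrightarrow> \<sigma> = Sink"
    and "n = a + b"
    and "k = (case \<sigma> of Sink \<Rightarrow> (a - b) div 2 | Source \<Rightarrow> (a + b) div 2)"
    and "finite A" and "card A = a" and "finite B" and "card B = b" and "A \<inter> B = {}"
  shows "(\<forall>S. S \<subseteq> A \<and> card S = k \<longrightarrow> mu (GG A B \<sigma>) (bits (A \<union> B) S) = fact (n div 2))
    \<and> {S. S \<subseteq> A \<and> card S = k} \<subseteq> sig (GG A B \<sigma>) ` coincidences (GG A B \<sigma>)
    \<and> card {S. S \<subseteq> A \<and> card S = k} = a choose k
    \<and> proportional (psi (GG A B \<sigma>)) (tensor A B (dicke A k) (zero_state B))"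
proof -
  let ?G = "GG A B \<sigma>" and ?T = "tensor A B (dicke A k) (zero_state B)"
  have eg: "experiment_graph ?G" using assms by (intro experiment_graph_GG)
  have paths: "paths ?G = A \<union> B" by (simp add: GG_def)
  have mu: "mu ?G (bits (A \<union> B) S) = (if S \<subseteq> A \<and> card S = k then fact (n div 2) else 0)"
    if "S \<subseteq> A \<union> B" for S
    using mu_GG[OF assms(7,9,11) that, unfolded assms(8,10), OF assms(2,3,6)] assms(5) by simp
  have "S \<in> sig ?G ` coincidences ?G" if S: "S \<subseteq> A" "card S = k" for S
  proof -
    have "S \<subseteq> A \<union> B" using S by blast
    then have "card {M \<in> coincidences ?G. sig ?G M = S} = fact (n div 2)"
      using mu[of S] mu_bits[OF eg, of S] S by (simp add: paths)
    \<comment> \<open>A factorial is positive, so some coincidence registers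
      \<open>S\<close>.\<close>
    then have "card {M \<in> coincidences ?G. sig ?G M = S} \<noteq> 0" by simp
    then have "{M \<in> coincidences ?G. sig ?G M = S} \<noteq> {}" by (metis card.empty)
    then show ?thesis by blast
  qed
  moreover have "proportional (psi ?G) ?T"
  proof -
    define r where "r = sqrt (real (a choose k))"
    \<comment> \<open>For a source this uses \<open>b \<le> a\<close>; it makes the binomial
      coefficient, and so \<open>r\<close>, nonzero.\<close>
    have "k \<le> a" using assms(2,6) by (cases \<sigma>) auto
    then have r: "r \<noteq> 0" by (simp add: r_def)
    \<comment> \<open>The factor \<open>r\<close> cancels the Dicke normalization, leaving the
      common multiplicity \<open>fact (n div 2)\<close>.\<close>
    have "psi ?G y = of_real (fact (n div 2) * r) * ?T y" for y
    proof (cases "y \<in> bitstrings (A \<union> B)")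
      case True
      \<comment> \<open>Every bitstring is the indicator of its set of ones, so the formulas for
        indicators cover all of them.\<close>
      define S where "S = {v \<in> A \<union> B. y v = 1}"
      have S: "S \<subseteq> A \<union> B" "y = bits (A \<union> B) S"
        using bitstrings_eq_bits[OF True] by (auto simp: S_def)
      show ?thesis
        using True psi_eq[OF eg, of y] mu[OF S(1)] r
          tensor_dicke_zero_bits[OF assms(7,11) S(1), of k] assms(8)
        by (simp add: S(2) paths flip: r_def)
    next
      case False
      then show ?thesis using psi_eq[OF eg, of y] by (simp add: paths tensor_def)
    qed
    moreover have "complex_of_real (fact (n div 2) * r) \<noteq> 0" using r by simp
    ultimately show ?thesis unfolding proportional_def by blast
  qed
  moreover have "card {S. S \<subseteq> A \<and> card S = k} = a choose k"
    using n_subsets[OF assms(7)] assms(8) by simp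
  moreover have "mu ?G (bits (A \<union> B) S) = fact (n div 2)" if "S \<subseteq> A" "card S = k" for S
    using mu[of S] that by (simp add: le_supI1)
  ultimately show ?thesis by blast
qed

end
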